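(* For all real numbers $t$: $$\operatorname{cl}(\sqrt{2}\,t)=\frac{\cos_4^2(t)-\sin_4^2(t)}{\cos_4^2(t)+\sin_4^2(t)},$$ where $\operatorname{cl}$ is the lemniscate cosine and $\cos_4,\sin_4$ are the squircular (4-norm) cosine and sine.
   Context: Lemniscate cosine: let $\varpi$ be the arc length of one lobe of the lemniscate $(x^2+y^2)^2=x^2-y^2$, so $\frac{\varpi}{2}=\int_0^1\frac{dr}{\sqrt{1-r^4}}$. Define $\operatorname{acl}:[0,1]\to[0,\frac{\varpi}{2}]$ by $\operatorname{acl}(R)=\int_R^1\frac{dr}{\sqrt{1-r^4}}$. On $[0,\frac{\varpi}{2}]$, $\operatorname{cl}$ is the inverse function of $\operatorname{acl}$; it is extended to all of $\mathbb{R}$ by symmetry and periodicity (as for the ordinary cosine): $\operatorname{cl}(\varpi-t)=-\operatorname{cl}(t)$, $\operatorname{cl}(-t)=\operatorname{cl}(t)$, and $\operatorname{cl}(t+2\varpi)=\operatorname{cl}(t)$. Squircular functions: consider a particle moving counterclockwise around the squircle $x^4+y^4=1$, at $(1,0)$ at time $t=0$, in such a way that the area swept out by the radius from the origin to the particle grows at the constant rate $\frac12$. Then $(\cos_4(t),\sin_4(t))$ is its position at time $t$ (for negative $t$ the motion is run backwards, i.e. clockwise from $(1,0)$; the functions are periodic with period twice the area enclosed by the squircle). In particular, while $(x,y)=(\cos_4(t),\sin_4(t))$ is in the first quadrant during the first revolution, $\frac12 t=\int_x^1\sqrt[4]{1-u^4}\,du+\frac12 x\sqrt[4]{1-x^4}$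 and $y=\sqrt[4]{1-x^4}$. *)

theory Defs
  imports "HOL-Analysis.Analysis"
begin

text \<open>
  The integrand \<open>1 / sqrt (1 - r^4)\<close> is unbounded at \<open>r = 1\<close>. The Henstock--Kurzweil integral
  agrees with the improper Riemann integral there; the value at the single point \<open>r = 1\<close> is
  irrelevant.
\<close>

definition lemniscate_const :: real where
  "lemniscate_const = 2 * integral {0..1} (\<lambda>r::real. 1 / sqrt (1 - r ^ 4))"

definition acl :: "real \<Rightarrow> real" where
  "acl R = integral {R..1} (\<lambda>r::real. 1 / sqrt (1 - r ^ 4))"

text \<open>
  Below, \<open>w\<close> is the lemniscate constant and \<open>s\<close> is the representative of \<open>\<plusminus>t\<close> modulo
  \<open>2 * w\<close> in \<open>[0, w]\<close> (periodicity and evenness); the second half of that interval is reached by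
  \<open>cl (w - s) = - cl s\<close>.
\<close>

definition cl :: "real \<Rightarrow> real" where
  "cl t =
     (let w = lemniscate_const;
          s = \<bar>t - 2 * w * of_int (round (t / (2 * w)))\<bar>
      in if s \<le> w / 2 then the_inv_into {0..1} acl s
         else - the_inv_into {0..1} acl (w - s))"

text \<open>The point of the squircle \<open>x^4 + y^4 = 1\<close> with polar angle \<open>\<phi>\<close>.\<close>

definition squircle_point :: "real \<Rightarrow> real \<times> real" where
  "squircle_point \<phi> =
     (let \<rho> = 1 / root 4 (cos \<phi> ^ 4 + sin \<phi> ^ 4) in (\<rho> * cos \<phi>, \<rho> * sin \<phi>))"

lemma squircle_point_on_squircle:
  "fst (squircle_point \<phi>) ^ 4 + snd (squircle_point \<phi>) ^ 4 = 1"
proof -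
  have "cos \<phi> \<noteq> 0 \<or> sin \<phi> \<noteq> 0"
    using sin_zero_abs_cos_one[of \<phi>] by auto
  then have pos: "cos \<phi> ^ 4 + sin \<phi> ^ 4 > 0"
    by (auto intro: add_pos_nonneg add_nonneg_pos)
  then show ?thesis
    by (simp add: squircle_point_def Let_def power_divide flip: add_divide_distrib)
qed

text \<open>
  The region swept out by the radius while the particle travels counterclockwise from
  \<open>(1, 0)\<close> to polar angle \<open>\<theta>\<close> (within one revolution).
\<close>

definition swept_region :: "real \<Rightarrow> (real \<times> real) set" where
  "swept_region \<theta> = (\<Union>\<phi>\<in>{0..\<theta>}. closed_segment (0, 0) (squircle_point \<phi>))"

definition squircle_area :: real where
  "squircle_area = measure lborel {(x, y). (x::real) ^ 4 + (y::real) ^ 4 \<le> 1}"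

text \<open>
  Polar angle of the particle at time \<open>t\<close>. One revolution takes time \<open>T = 2 * squircle_area\<close>,
  since area is swept out at rate \<open>1/2\<close>; \<open>t\<close> is first reduced modulo \<open>T\<close> to \<open>[0, T)\<close>, which
  covers later revolutions and, for negative \<open>t\<close>, the motion run backwards.
\<close>

definition squircular_angle :: "real \<Rightarrow> real" where
  "squircular_angle t =
     (let T = 2 * squircle_area;
          s = t - T * of_int \<lfloor>t / T\<rfloor>
      in THE \<theta>. 0 \<le> \<theta> \<and> \<theta> < 2 * pi \<and> measure lborel (swept_region \<theta>) = s / 2)"

definition cos4 :: "real \<Rightarrow> real" where
  "cos4 t = fst (squircle_point (squircular_angle t))"

definition sin4 :: "real \<Rightarrow> real" where
  "sin4 t = snd (squircle_point (squircular_angle t))"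

end

theory Submission
  imports Defs
begin

text \<open>
  Put \<open>F x = \<integral>\<^sub>0\<^sup>x d\<psi> / sqrt (1 + cos\<^sup>2 \<psi>)\<close>. Substituting \<open>r = cos \<psi>\<close> gives \<open>acl (cos \<psi>) = F \<psi>\<close> on
  \<open>[0, \<pi>/2]\<close>, and since \<open>F\<close> is odd with \<open>F (x + \<pi>) = F x + F \<pi>\<close>, this yields \<open>cl (F x) = cos x\<close> for
  all real \<open>x\<close>. On the other side, the squircle has squared polar radius \<open>1 / sqrt (cos\<^sup>4 \<phi> + sin\<^sup>4 \<phi>)\<close>, and
  \<open>2 (cos\<^sup>4 \<phi> + sin\<^sup>4 \<phi>) = 1 + cos\<^sup>2 (2 \<phi>)\<close>, so the radius sweeps out the area \<open>F (2 \<theta>) / (2 sqrt 2)\<close>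
  up to angle \<open>\<theta>\<close>. At time \<open>t\<close> this area is \<open>t / 2\<close>, that is \<open>F (2 \<theta>) = sqrt 2 * t\<close>; hence
  \<open>cl (sqrt 2 * t) = cos (2 \<theta>)\<close>, which is the right-hand side.

  Sector areas are computed in the coordinates \<open>(x, m)\<close> with \<open>y = m x\<close>, where the area element is
  \<open>x dx dm\<close>. It suffices to bound every sector from above and the whole squircle from below:
  a strict inequality for one sector would contradict the total.
\<close>

section \<open>The lemniscate cosine\<close>

text \<open>Since \<open>1 + cos^2 = 2 - sin^2\<close>, this is the incomplete elliptic integral of
  the first kind with squared modulus 1/2, divided by \<open>sqrt 2\<close>. The oriented interval
  integral covers negative arguments too.\<close>

definition cos_arc :: "real \<Rightarrow> real" where
  "cos_arc x = (LBINT \<psi>=0..x. 1 / sqrt (1 + (cos \<psi>)\<^sup>2))"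

lemma cos_arc_0 [simp]: "cos_arc 0 = 0"
  by (simp add: cos_arc_def zero_ereal_def)

lemma one_plus_cos_square_pos: "1 + (cos x)\<^sup>2 > (0::real)"
  by (simp add: add_pos_nonneg)

text \<open>The continuous integrand has one antiderivative on the whole line, and
  \<open>cos_arc\<close> differs from it by a constant; this gives two-sided derivatives everywhere,
  also at 0 and to its left.\<close>

lemma DERIV_cos_arc: "(cos_arc has_real_derivative 1 / sqrt (1 + (cos x)\<^sup>2)) (at x)"
proof -
  let ?f = "\<lambda>x::real. 1 / sqrt (1 + (cos x)\<^sup>2)"
  have nz: "1 + (cos y)\<^sup>2 \<noteq> 0" for y :: real
    using one_plus_cos_square_pos[of y] by simp
  have cont: "isCont ?f y" for y
    by (intro continuous_intros) (use nz in auto)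
  have "\<exists>F. \<forall>x :: real. -\<infinity> < ereal x \<longrightarrow> ereal x < \<infinity> \<longrightarrow> (F has_vector_derivative ?f x) (at x)"
    by (rule einterval_antiderivative) (use cont in auto)
  then obtain F where F: "\<And>x. (F has_vector_derivative ?f x) (at x)"
    by auto
  have "cos_arc y = F y - F 0" for y
    unfolding cos_arc_def zero_ereal_def
  proof (rule interval_integral_FTC_finite)
    show "continuous_on {min 0 y..max 0 y} ?f"
      using cont by (auto intro: continuous_at_imp_continuous_on)
    show "(F has_vector_derivative ?f z) (at z within {min 0 y..max 0 y})"
      if "min 0 y \<le> z" "z \<le> max 0 y" for z
      using F has_vector_derivative_at_within by blast
  qed
  then have "cos_arc = (\<lambda>y. F y - F 0)"
    by auto
  moreover have "((\<lambda>y. F y - F 0) has_real_derivative ?f x) (at x)"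
    using F[of x] by (auto intro!: derivative_eq_intros simp: has_real_derivative_iff_has_vector_derivative)
  ultimately show ?thesis
    by simp
qed

lemma DERIV_cos_arc' [derivative_intros]:
  assumes "(g has_real_derivative g') (at x within S)"
  shows "((\<lambda>x. cos_arc (g x)) has_real_derivative 1 / sqrt (1 + (cos (g x))\<^sup>2) * g') (at x within S)"
  using DERIV_chain2[OF DERIV_cos_arc assms] .

lemma continuous_on_cos_arc: "continuous_on S cos_arc"
  using DERIV_cos_arc by (blast intro: continuous_at_imp_continuous_on DERIV_isCont)

lemma cos_arc_strict_mono: "strict_mono cos_arc"
proof (rule strict_monoI)
  fix x y :: real
  assume "x < y"
  then show "cos_arc x < cos_arc y"
  proof (rule DERIV_pos_imp_increasing)
    fix z
    have "0 < 1 / sqrt (1 + (cos z)\<^sup>2)"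
      using one_plus_cos_square_pos[of z] by simp
    then show "\<exists>d. DERIV cos_arc z :> d \<and> 0 < d"
      using DERIV_cos_arc by blast
  qed
qed

lemmas cos_arc_less_iff = strict_mono_less[OF cos_arc_strict_mono]
lemmas cos_arc_le_iff = strict_mono_less_eq[OF cos_arc_strict_mono]

lemma cos_arc_minus: "cos_arc (- x) = - cos_arc x"
proof -
  have "((\<lambda>x. cos_arc (- x) + cos_arc x) has_real_derivative 0) (at y)" for y
    by (auto intro!: derivative_eq_intros)
  then have "cos_arc (- x) + cos_arc x = cos_arc (- 0) + cos_arc 0"
    by (intro DERIV_isconst_all) auto
  then show ?thesis
    by simp
qed

text \<open>The integrand involves only the square of the cosine and so has period
  \<open>pi\<close>; hence the increment over a length \<open>pi\<close> has derivative 0.\<close>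

lemma cos_arc_add_pi: "cos_arc (x + pi) = cos_arc x + cos_arc pi"
proof -
  have "((\<lambda>x. cos_arc (x + pi) - cos_arc x) has_real_derivative 0) (at y)" for y
    by (auto intro!: derivative_eq_intros)
  then have "cos_arc (x + pi) - cos_arc x = cos_arc (0 + pi) - cos_arc 0"
    by (intro DERIV_isconst_all) auto
  then show ?thesis
    by simp
qed

lemma cos_arc_add_nat_pi: "cos_arc (x + of_nat n * pi) = cos_arc x + of_nat n * cos_arc pi"
proof (induction n)
  case (Suc n)
  then show ?case
    using cos_arc_add_pi[of "x + of_nat n * pi"] by (simp add: algebra_simps)
qed simp

lemma cos_arc_add_int_pi: "cos_arc (x + of_int k * pi) = cos_arc x + of_int k * cos_arc pi"
proof (cases k rule: int_cases2)
  case (nonneg n)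
  then show ?thesis
    by (simp add: cos_arc_add_nat_pi)
next
  case (nonpos n)
  then show ?thesis
    using cos_arc_add_nat_pi[of "x - of_nat n * pi" n] by simp
qed

lemma cos_arc_pi_half: "cos_arc pi = 2 * cos_arc (pi / 2)"
  using cos_arc_add_pi[of "- (pi / 2)"] by (simp add: cos_arc_minus)

lemma cos_arc_pi_pos: "cos_arc pi > 0"
  using cos_arc_less_iff[of 0 pi] by simp

section \<open>Inversion of \<open>acl\<close> and the values of \<open>cl\<close>\<close>

text \<open>An antiderivative of the lemniscate integrand is \<open>- cos_arc (arccos r)\<close>.
  The fundamental theorem needs its derivative only in the open interval, so continuity of
  \<open>arccos\<close> at 1 takes care of the singularity.\<close>

lemma acl_cos:
  assumes "0 \<le> \<psi>" "\<psi> \<le> pi / 2"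
  shows "acl (cos \<psi>) = cos_arc \<psi>"
proof -
  have "((\<lambda>r. 1 / sqrt (1 - r ^ 4)) has_integral - cos_arc (arccos 1) - - cos_arc (arccos (cos \<psi>)))
    {cos \<psi>..1}"
  proof (rule fundamental_theorem_of_calculus_interior)
    have "0 \<le> cos \<psi>"
      using assms by (intro cos_ge_zero) auto
    then have sub: "{cos \<psi>..1} \<subseteq> {-1..1}"
      by auto
    show "continuous_on {cos \<psi>..1} (\<lambda>r. - cos_arc (arccos r))"
      by (intro continuous_intros continuous_on_compose2[OF continuous_on_cos_arc[of UNIV]]
          continuous_on_subset[OF continuous_on_arccos' sub]) auto
    fix r :: real
    assume r: "r \<in> {cos \<psi><..<1}"
    then have r01: "0 < r" "r < 1"
      using \<open>0 \<le> cos \<psi>\<close> by auto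
    have "((\<lambda>r. - cos_arc (arccos r)) has_real_derivative
        - (1 / sqrt (1 + (cos (arccos r))\<^sup>2) * inverse (- sqrt (1 - r\<^sup>2)))) (at r)"
      using r01 by (intro DERIV_minus DERIV_cos_arc' DERIV_arccos) auto
    \<comment> \<open>The two factors of \<open>1 - r^4\<close> come from different places:
      \<open>1 + r^2\<close> from \<open>cos_arc\<close>, \<open>1 - r^2\<close> from
      \<open>arccos\<close>.\<close>
    moreover have "- (1 / sqrt (1 + (cos (arccos r))\<^sup>2) * inverse (- sqrt (1 - r\<^sup>2))) = 1 / sqrt (1 - r ^ 4)"
    proof -
      have "1 - r ^ 4 = (1 + r\<^sup>2) * (1 - r\<^sup>2)"
        by algebra
      then show ?thesis
        using r01 by (simp add: real_sqrt_mult divide_simps)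
    qed
    ultimately show "((\<lambda>r. - cos_arc (arccos r)) has_vector_derivative 1 / sqrt (1 - r ^ 4)) (at r)"
      by (simp add: has_real_derivative_iff_has_vector_derivative)
  qed auto
  moreover have "arccos (cos \<psi>) = \<psi>"
    using assms by (intro arccos_cos) auto
  ultimately show ?thesis
    unfolding acl_def by (simp add: integral_unique)
qed

lemma lemniscate_const_eq: "lemniscate_const = cos_arc pi"
  using acl_cos[of "pi / 2"] by (simp add: acl_def lemniscate_const_def cos_arc_pi_half)

text \<open>Every point of \<open>[0, 1]\<close> is the cosine of an angle in
  \<open>[0, pi/2]\<close>, and along these angles \<open>acl\<close> becomes the strictly
  increasing \<open>cos_arc\<close>; so \<open>acl\<close> is injective.\<close>

lemma inv_acl_cos_arc:
  assumes "0 \<le> \<psi>" "\<psi> \<le> pi / 2"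
  shows "the_inv_into {0..1} acl (cos_arc \<psi>) = cos \<psi>"
proof (rule the_inv_into_f_eq)
  show "inj_on acl {0..1}"
  proof (rule inj_onI)
    fix x y :: real
    assume xy: "x \<in> {0..1}" "y \<in> {0..1}" "acl x = acl y"
    have bounds: "0 \<le> arccos z" "arccos z \<le> pi / 2" "cos (arccos z) = z" if "z \<in> {0..1}" for z
      using that arccos_le_pi2[of z] by (auto intro: arccos_lbound)
    have "cos_arc (arccos x) = cos_arc (arccos y)"
      using xy acl_cos[of "arccos x"] acl_cos[of "arccos y"] bounds by simp
    then have "arccos x = arccos y"
      using strict_mono_eq[OF cos_arc_strict_mono] by blast
    then show "x = y"
      using bounds(3) xy by metis
  qed
  show "acl (cos \<psi>) = cos_arc \<psi>"
    by (rule acl_cos[OF assms])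
  show "cos \<psi> \<in> {0..1}"
    using assms by (auto intro: cos_ge_zero)
qed

text \<open>The reductions inside \<open>cl\<close> mirror those of the cosine: subtracting
  \<open>2 * w\<close> from the argument shifts the angle by \<open>2 * pi\<close>, and
  \<open>w - s\<close> corresponds to the supplementary angle.\<close>

lemma cl_cos_arc: "cl (cos_arc x) = cos x"
proof -
  define w where "w = cos_arc pi"
  define k where "k = round (cos_arc x / (2 * w))"
  define y where "y = x + of_int (- 2 * k) * pi"
  have w: "w > 0"
    using cos_arc_pi_pos by (simp add: w_def)
  have Fy: "cos_arc y = cos_arc x - 2 * w * of_int k"
    unfolding y_def cos_arc_add_int_pi w_def by simp
  have s: "\<bar>cos_arc y\<bar> = cos_arc \<bar>y\<bar>"
    using cos_arc_less_iff[of y 0] by (auto simp: abs_if cos_arc_minus)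
  \<comment> \<open>Rounding to the nearest integer leaves a remainder of at most \<open>w\<close>
    in absolute value; by monotonicity the shifted angle \<open>y\<close> lies in
    \<open>[-pi, pi]\<close>.\<close>
  have "\<bar>of_int k - cos_arc x / (2 * w)\<bar> \<le> 1 / 2"
    unfolding k_def by (rule of_int_round_abs_le)
  then have "\<bar>cos_arc y\<bar> \<le> w"
    using w unfolding Fy by (simp add: abs_le_iff field_simps)
  then have ypi: "\<bar>y\<bar> \<le> pi"
    unfolding s w_def cos_arc_le_iff .
  have "cos x = cos (y + of_int (2 * k) * pi)"
    by (simp add: y_def)
  also have "\<dots> = cos y"
    using cos_int_2pin[of k] sin_int_2pin[of k] by (simp add: cos_add mult_ac)
  finally have cos: "cos x = cos \<bar>y\<bar>"
    by simp
  have half: "w / 2 = cos_arc (pi / 2)"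
    by (simp add: w_def cos_arc_pi_half)
  have cl: "cl (cos_arc x) = (if cos_arc \<bar>y\<bar> \<le> w / 2 then the_inv_into {0..1} acl (cos_arc \<bar>y\<bar>)
         else - the_inv_into {0..1} acl (w - cos_arc \<bar>y\<bar>))"
    unfolding cl_def lemniscate_const_eq Let_def w_def[symmetric] k_def[symmetric] Fy[symmetric] s ..
  show ?thesis
  proof (cases "\<bar>y\<bar> \<le> pi / 2")
    case True
    then show ?thesis
      by (simp add: cl half cos_arc_le_iff inv_acl_cos_arc cos)
  next
    case False
    have "w - cos_arc \<bar>y\<bar> = cos_arc (pi - \<bar>y\<bar>)"
      using cos_arc_add_pi[of "- \<bar>y\<bar>"] by (simp add: w_def cos_arc_minus)
    then show ?thesis
      using False ypi by (simp add: cl half cos_arc_le_iff inv_acl_cos_arc cos cos_diff)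
  qed
qed

section \<open>The area of squircular sectors\<close>

text \<open>Closed form of half the integral of the squared polar radius from 0 to the given angle.
  That it measures the swept region is a theorem, proved only in
  \<open>measure_swept_region\<close>.\<close>

definition sector_area :: "real \<Rightarrow> real" where
  "sector_area \<theta> = cos_arc (2 * \<theta>) / (2 * sqrt 2)"

lemma cos4_sin4_pos: "cos x ^ 4 + sin x ^ 4 > (0::real)"
proof -
  have "cos x \<noteq> 0 \<or> sin x \<noteq> 0"
    using sin_zero_abs_cos_one[of x] by auto
  then show ?thesis
    by (auto intro: add_pos_nonneg add_nonneg_pos)
qed

lemma DERIV_sector_area:
  "(sector_area has_real_derivative 1 / (2 * sqrt (cos x ^ 4 + sin x ^ 4))) (at x)"
proof -
  have "(sector_area has_real_derivative 1 / sqrt (1 + (cos (2 * x))\<^sup>2) / sqrt 2) (at x)"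
    unfolding sector_area_def by (auto intro!: derivative_eq_intros simp: real_div_sqrt divide_simps)
  moreover have "sqrt (1 + (cos (2 * x))\<^sup>2) = sqrt 2 * sqrt (cos x ^ 4 + sin x ^ 4)"
  proof -
    have "1 + (cos (2 * x))\<^sup>2 = ((cos x)\<^sup>2 + (sin x)\<^sup>2)\<^sup>2 + ((cos x)\<^sup>2 - (sin x)\<^sup>2)\<^sup>2"
      by (simp add: cos_double)
    also have "\<dots> = 2 * (cos x ^ 4 + sin x ^ 4)"
      by algebra
    finally show ?thesis
      by (simp only: real_sqrt_mult)
  qed
  moreover have "1 / (sqrt 2 * y) / sqrt 2 = 1 / (2 * y)" for y
    by (simp add: divide_divide_eq_left mult.assoc mult.left_commute)
  ultimately show ?thesis
    by (simp only:)
qed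

lemma sector_area_strict_mono: "strict_mono sector_area"
  by (rule strict_monoI) (simp add: sector_area_def divide_strict_right_mono cos_arc_less_iff)

lemma sector_area_add_half_pi: "sector_area (x + pi / 2) = sector_area x + sector_area (pi / 2)"
  using cos_arc_add_pi[of "2 * x"] by (simp add: sector_area_def algebra_simps add_divide_distrib)

lemma sector_area_0 [simp]: "sector_area 0 = 0"
  by (simp add: sector_area_def)

text \<open>In terms of the slope \<open>m\<close>, this is the density of area: the ray of slope
  \<open>m\<close> leaves the squircle at the abscissa \<open>r\<close> with
  \<open>r^4 = 1 / (1 + m^4)\<close>, and the integral of \<open>x\<close> from 0 to
  \<open>r\<close> is \<open>r^2 / 2\<close>.\<close>

lemma DERIV_sector_area_arctan:
  "((\<lambda>m. sector_area (arctan m)) has_real_derivative 1 / (2 * sqrt (1 + m ^ 4))) (at m)"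
proof -
  have "((\<lambda>m. sector_area (arctan m)) has_real_derivative
      1 / (2 * sqrt (cos (arctan m) ^ 4 + sin (arctan m) ^ 4)) * inverse (1 + m\<^sup>2)) (at m)"
    by (rule DERIV_chain2[OF DERIV_sector_area DERIV_arctan])
  moreover have "sqrt (cos (arctan m) ^ 4 + sin (arctan m) ^ 4) = sqrt (1 + m ^ 4) / (1 + m\<^sup>2)"
  proof -
    have "sqrt (1 + m\<^sup>2) ^ 4 = (1 + m\<^sup>2)\<^sup>2"
      by (metis (no_types) power2_eq_square power4_eq_xxxx mult.assoc real_sqrt_pow2 add_nonneg_nonneg zero_le_one zero_le_power2)
    then have "cos (arctan m) ^ 4 + sin (arctan m) ^ 4 = (1 + m ^ 4) / (1 + m\<^sup>2)\<^sup>2"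
      by (simp add: cos_arctan sin_arctan power_divide add_divide_distrib)
    then show ?thesis
      by (simp add: real_sqrt_divide)
  qed
  moreover have "1 + m\<^sup>2 > 0" "1 + m ^ 4 > 0"
    by (auto intro: add_pos_nonneg)
  ultimately show ?thesis
    by (simp add: field_simps)
qed

section \<open>Area of a wedge between two slopes\<close>

definition squircle_disc :: "(real \<times> real) set" where
  "squircle_disc = {(x, y). x ^ 4 + y ^ 4 \<le> 1}"

definition squircle_wedge :: "real \<Rightarrow> real \<Rightarrow> (real \<times> real) set" where
  "squircle_wedge c d = {(x, y). 0 < x \<and> c * x \<le> y \<and> y \<le> d * x \<and> x ^ 4 + y ^ 4 \<le> 1}"

lemma closed_squircle_disc: "closed squircle_disc"
  unfolding squircle_disc_def case_prod_unfold by (intro closed_Collect_le continuous_intros)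

lemma squircle_wedge_borel [measurable]: "squircle_wedge c d \<in> sets borel"
proof -
  have "closed {p::real \<times> real. c * fst p \<le> snd p}" "closed {p::real \<times> real. snd p \<le> d * fst p}"
    by (intro closed_Collect_le continuous_intros)+
  moreover have "open {p::real \<times> real. 0 < fst p}"
    by (intro open_Collect_less continuous_intros)
  moreover have "squircle_wedge c d = {p. 0 < fst p} \<inter> {p. c * fst p \<le> snd p} \<inter> {p. snd p \<le> d * fst p} \<inter> squircle_disc"
    by (auto simp: squircle_wedge_def squircle_disc_def)
  ultimately show ?thesis
    using closed_squircle_disc by (auto intro!: sets.Int)
qed

text \<open>For fixed \<open>x\<close> the substitution \<open>y = m * x\<close> turns a vertical
  slice into a range of slopes. Tonelli then allows integrating over \<open>x\<close> first, which
  leaves the slope density of \<open>DERIV_sector_area_arctan\<close>.\<close>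

lemma emeasure_squircle_wedge:
  assumes "c \<le> d"
  shows "emeasure lborel (squircle_wedge c d) = ennreal (sector_area (arctan d) - sector_area (arctan c))"
proof -
  \<comment> \<open>The set of pairs, slope first, expresses \<open>x^4 + y^4 \<le> 1\<close> for
    \<open>y = m * x\<close>; the last factor \<open>x\<close> is the Jacobian.\<close>
  define f :: "real \<Rightarrow> real \<Rightarrow> ennreal"
    where "f x m = indicator {0<..} x * indicator {c..d} m * indicator {p. snd p ^ 4 * (1 + fst p ^ 4) \<le> 1} (m, x) * ennreal x" for x m
  have inner: "(\<integral>\<^sup>+x. f x m \<partial>lborel) = ennreal (1 / (2 * sqrt (1 + m ^ 4))) * indicator {c..d} m" for m
  proof -
    define r where "r = 1 / root 4 (1 + m ^ 4)"
    have m4: "1 + m ^ 4 > 0"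
      by (auto intro: add_pos_nonneg)
    have r: "r > 0" "r ^ 4 = 1 / (1 + m ^ 4)"
      using m4 by (auto simp: r_def power_divide)
    have "x ^ 4 * (1 + m ^ 4) \<le> 1 \<longleftrightarrow> x \<le> r" if "0 < x" for x
    proof -
      have "x ^ 4 * (1 + m ^ 4) \<le> 1 \<longleftrightarrow> x ^ 4 \<le> r ^ 4"
        using m4 by (simp add: r(2) field_simps)
      then show ?thesis
        using that r(1) by (simp add: power_mono_iff)
    qed
    then have "f x m = ennreal x * indicator {0..r} x * indicator {c..d} m" for x
      by (auto simp: f_def indicator_def)
    then have "(\<integral>\<^sup>+x. f x m \<partial>lborel) = (\<integral>\<^sup>+x. ennreal x * indicator {0..r} x \<partial>lborel) * indicator {c..d} m"
      by (simp add: nn_integral_multc)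
    also have "(\<integral>\<^sup>+x. ennreal x * indicator {0..r} x \<partial>lborel) = ennreal (r\<^sup>2 / 2 - 0\<^sup>2 / 2)"
      using r by (intro nn_integral_FTC_Icc) (auto intro!: derivative_eq_intros)
    also have "r\<^sup>2 = 1 / sqrt (1 + m ^ 4)"
    proof (rule power2_eq_imp_eq)
      show "(r\<^sup>2)\<^sup>2 = (1 / sqrt (1 + m ^ 4))\<^sup>2"
        using r m4 by (simp add: power_divide)
    qed (use m4 in auto)
    finally show ?thesis
      by (simp add: mult.commute)
  qed
  have "emeasure lborel (squircle_wedge c d) = (\<integral>\<^sup>+x. emeasure lborel (Pair x -` squircle_wedge c d) \<partial>lborel)"
    unfolding lborel_prod[symmetric]
    by (rule lborel.emeasure_pair_measure_alt) (unfold lborel_prod, simp)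
  also have "\<dots> = (\<integral>\<^sup>+x. \<integral>\<^sup>+m. f x m \<partial>lborel \<partial>lborel)"
  proof (rule nn_integral_cong)
    fix x :: real
    have meas: "Pair x -` squircle_wedge c d \<in> sets borel"
      using sets_Pair1[of "squircle_wedge c d" borel borel x] unfolding borel_prod by simp
    show "emeasure lborel (Pair x -` squircle_wedge c d) = (\<integral>\<^sup>+m. f x m \<partial>lborel)"
    proof (cases "x > 0")
      case True
      have "emeasure lborel (Pair x -` squircle_wedge c d) = (\<integral>\<^sup>+y. indicator (Pair x -` squircle_wedge c d) y \<partial>lborel)"
        using meas by simp
      also have "\<dots> = ennreal \<bar>x\<bar> * (\<integral>\<^sup>+m. indicator (Pair x -` squircle_wedge c d) (0 + x * m) \<partial>lborel)"
        using True meas by (intro nn_integral_real_affine) auto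
      also have "\<dots> = (\<integral>\<^sup>+m. ennreal \<bar>x\<bar> * indicator (Pair x -` squircle_wedge c d) (0 + x * m) \<partial>lborel)"
        using meas by (intro nn_integral_cmult[symmetric]) measurable
      also have "\<dots> = (\<integral>\<^sup>+m. f x m \<partial>lborel)"
        using True by (intro nn_integral_cong)
          (auto simp: f_def indicator_def squircle_wedge_def power_mult_distrib algebra_simps)
      finally show ?thesis .
    next
      case False
      then have "Pair x -` squircle_wedge c d = {}"
        by (auto simp: squircle_wedge_def)
      then show ?thesis
        using False by (simp add: f_def)
    qed
  qed
  also have "\<dots> = (\<integral>\<^sup>+m. \<integral>\<^sup>+x. f x m \<partial>lborel \<partial>lborel)"
  proof (rule lborel_pair.Fubini'[symmetric])
    have "closed {p::real\<times>real. snd p ^ 4 * (1 + fst p ^ 4) \<le> 1}"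
      by (intro closed_Collect_le continuous_intros)
    then have [measurable]: "{p::real\<times>real. snd p ^ 4 * (1 + fst p ^ 4) \<le> 1} \<in> sets (borel \<Otimes>\<^sub>M borel)"
      unfolding borel_prod by simp
    show "(\<lambda>(x, m). f x m) \<in> borel_measurable (lborel \<Otimes>\<^sub>M lborel)"
      unfolding f_def case_prod_unfold by measurable
  qed
  also have "\<dots> = ennreal (sector_area (arctan d) - sector_area (arctan c))"
    unfolding inner using assms
    by (intro nn_integral_FTC_Icc) (auto intro: has_field_derivative_at_within DERIV_sector_area_arctan)
  finally show ?thesis .
qed

section \<open>Invariance of area under quarter turns\<close>

definition quarter_turn :: "real \<times> real \<Rightarrow> real \<times> real" where
  "quarter_turn p = (- snd p, fst p)"

lemma quarter_turn_image: "quarter_turn ` A = {(x, y). (y, - x) \<in> A}"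
  by (force simp: quarter_turn_def image_iff)

lemma quarter_turn_image_borel:
  assumes "A \<in> sets borel"
  shows "quarter_turn ` A \<in> sets borel"
proof -
  have "(\<lambda>p::real\<times>real. (snd p, - fst p)) -` A \<inter> space borel \<in> sets borel"
    using assms by (intro measurable_sets[OF borel_measurable_continuous_onI]) (auto intro!: continuous_intros)
  also have "(\<lambda>p::real\<times>real. (snd p, - fst p)) -` A \<inter> space borel = quarter_turn ` A"
    by (auto simp: quarter_turn_image)
  finally show ?thesis .
qed

text \<open>The vertical slice of the turned set at \<open>x\<close> is the horizontal slice of
  \<open>A\<close> at height \<open>- x\<close>; both measures are integrals of slice lengths, up to
  the reflection \<open>x\<close> to \<open>- x\<close>.\<close>

lemma emeasure_quarter_turn:
  assumes "A \<in> sets borel"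
  shows "emeasure lborel (quarter_turn ` A) = emeasure lborel A"
proof -
  have A: "A \<in> sets (lborel \<Otimes>\<^sub>M lborel)"
    using assms unfolding lborel_prod by simp
  define h where "h y = emeasure lborel ((\<lambda>x. (x, y)) -` A)" for y
  have h: "h \<in> borel_measurable borel"
    unfolding h_def using lborel_pair.measurable_emeasure_Pair2[OF A] by simp
  have "emeasure lborel (quarter_turn ` A) = (\<integral>\<^sup>+x. emeasure lborel (Pair x -` (quarter_turn ` A)) \<partial>lborel)"
    unfolding lborel_prod[symmetric]
    by (rule lborel.emeasure_pair_measure_alt) (unfold lborel_prod, simp add: quarter_turn_image_borel assms)
  also have "\<dots> = (\<integral>\<^sup>+x. h (- x) \<partial>lborel)"
    by (simp add: h_def quarter_turn_image vimage_def)
  also have "\<dots> = (\<integral>\<^sup>+x. h x \<partial>lborel)"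
    using nn_integral_real_affine[OF h, of "-1" 0] by simp
  also have "\<dots> = emeasure lborel A"
    unfolding h_def lborel_prod[symmetric] by (rule lborel_pair.emeasure_pair_measure_alt2[symmetric, OF A])
  finally show ?thesis .
qed

section \<open>Sectors of the squircle\<close>

text \<open>A free initial angle lets swept regions be cut into pieces and turned.\<close>

definition sector :: "real \<Rightarrow> real \<Rightarrow> (real \<times> real) set" where
  "sector a b = (\<Union>\<phi>\<in>{a..b}. closed_segment (0, 0) (squircle_point \<phi>))"

lemma swept_region_eq_sector: "swept_region \<theta> = sector 0 \<theta>"
  by (simp add: swept_region_def sector_def)

lemma mem_sector_iff: "p \<in> sector a b \<longleftrightarrow> (\<exists>\<phi>\<in>{a..b}. \<exists>u\<in>{0..1}. p = u *\<^sub>R squircle_point \<phi>)"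
  by (auto simp: sector_def in_segment zero_prod_def[symmetric] Bex_def)

lemma continuous_on_squircle_point: "continuous_on S squircle_point"
proof -
  have "root 4 (cos x ^ 4 + sin x ^ 4) \<noteq> 0" for x :: real
    using cos4_sin4_pos[of x] by simp
  then show ?thesis
    unfolding squircle_point_def Let_def by (intro continuous_intros) auto
qed

text \<open>A sector is the continuous image of a rectangle of scale factors and angles. Compactness
  supplies both measurability and finite area.\<close>

lemma compact_sector: "compact (sector a b)"
proof -
  have "compact ((\<lambda>z. fst z *\<^sub>R squircle_point (snd z)) ` ({0..1} \<times> {a..b}))"
    by (intro compact_continuous_image compact_Times compact_Icc continuous_intros
        continuous_on_compose2[OF continuous_on_squircle_point[of UNIV]]) auto
  also have "(\<lambda>z. fst z *\<^sub>R squircle_point (snd z)) ` ({0..1} \<times> {a..b}) = sector a b"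
    unfolding set_eq_iff mem_sector_iff image_iff by (metis mem_Times_iff fst_conv snd_conv)
  finally show ?thesis .
qed

lemma sector_borel: "sector a b \<in> sets borel"
  by (rule borel_compact[OF compact_sector])

lemma squircle_point_add_half_pi: "squircle_point (\<phi> + pi / 2) = quarter_turn (squircle_point \<phi>)"
  by (simp add: squircle_point_def Let_def quarter_turn_def cos_add sin_add add.commute)

lemma sector_add_half_pi: "sector (a + pi / 2) (b + pi / 2) = quarter_turn ` sector a b"
proof -
  have scale: "u *\<^sub>R quarter_turn p = quarter_turn (u *\<^sub>R p)" for u p
    by (simp add: quarter_turn_def)
  have ivl: "{a + pi / 2..b + pi / 2} = (\<lambda>\<phi>. \<phi> + pi / 2) ` {a..b}"
    by (simp add: image_add_atLeastAtMost')
  have "p \<in> sector (a + pi / 2) (b + pi / 2) \<longleftrightarrow> p \<in> quarter_turn ` sector a b" for p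
  proof -
    have "p \<in> sector (a + pi / 2) (b + pi / 2) \<longleftrightarrow>
        (\<exists>\<phi>\<in>{a..b}. \<exists>u\<in>{0..1}. p = quarter_turn (u *\<^sub>R squircle_point \<phi>))"
      by (simp only: mem_sector_iff ivl bex_simps squircle_point_add_half_pi scale)
    also have "\<dots> \<longleftrightarrow> p \<in> quarter_turn ` sector a b"
      unfolding image_iff Bex_def mem_sector_iff by blast
    finally show ?thesis .
  qed
  then show ?thesis
    by blast
qed

lemma sector_subset_disc: "sector a b \<subseteq> squircle_disc"
proof
  fix p
  assume "p \<in> sector a b"
  then obtain \<phi> u where p: "p = u *\<^sub>R squircle_point \<phi>" "0 \<le> u" "u \<le> 1"
    by (auto simp: mem_sector_iff)
  have "fst p ^ 4 + snd p ^ 4 = u ^ 4 * (fst (squircle_point \<phi>) ^ 4 + snd (squircle_point \<phi>) ^ 4)"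
    by (simp add: p power_mult_distrib distrib_left)
  also have "\<dots> \<le> 1"
    using p by (simp add: squircle_point_on_squircle power_le_one)
  finally show "p \<in> squircle_disc"
    by (simp add: squircle_disc_def case_prod_unfold)
qed

lemma disc_subset_sector: "squircle_disc \<subseteq> sector 0 (2 * pi)"
proof
  fix p
  assume p: "p \<in> squircle_disc"
  obtain x y where xy: "p = (x, y)"
    by (cases p)
  obtain r \<phi> where r: "0 \<le> r" "x = r * cos \<phi>" "y = r * sin \<phi>" "0 \<le> \<phi>" "\<phi> < 2 * pi"
  proof -
    let ?z = "Complex x y"
    have "?z = rcis (cmod ?z) (Arg2pi ?z)"
      using Arg2pi_eq[of ?z] by (simp add: rcis_def cis_conv_exp)
    then have "x = cmod ?z * cos (Arg2pi ?z)" "y = cmod ?z * sin (Arg2pi ?z)"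
      by (metis complex.sel Re_rcis, metis complex.sel Im_rcis)
    then show thesis
      using Arg2pi_ge_0[of ?z] Arg2pi_lt_2pi[of ?z] that norm_ge_zero by blast
  qed
  define q where "q = root 4 (cos \<phi> ^ 4 + sin \<phi> ^ 4)"
  have q: "q > 0" "q ^ 4 = cos \<phi> ^ 4 + sin \<phi> ^ 4"
    using cos4_sin4_pos[of \<phi>] by (auto simp: q_def)
  have "(r * q) ^ 4 \<le> 1"
    using p by (simp add: xy squircle_disc_def r power_mult_distrib q distrib_left)
  \<comment> \<open>The instance 3 stands for the exponent \<open>Suc 3\<close>, that is 4.\<close>
  then have "r * q \<le> 1"
    using power_le_imp_le_base[of "r * q" 3 1] by simp
  moreover have "p = (r * q) *\<^sub>R squircle_point \<phi>"
    using q by (simp add: xy r squircle_point_def Let_def q_def[symmetric])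
  ultimately show "p \<in> sector 0 (2 * pi)"
    using r q unfolding mem_sector_iff by (intro bexI[of _ \<phi>] bexI[of _ "r * q"]) auto
qed

lemma sector_full: "sector 0 (2 * pi) = squircle_disc"
  using disc_subset_sector sector_subset_disc by blast

lemma emeasure_lborel_insert:
  fixes A :: "'a::euclidean_space set"
  assumes "A \<in> sets borel"
  shows "emeasure lborel (insert x A) = emeasure lborel A"
proof -
  have "emeasure lborel (A \<union> {x}) = emeasure lborel A"
    using assms by (intro emeasure_Un_null_set) auto
  then show ?thesis
    by simp
qed

section \<open>Upper bound for the area of a sector\<close>

text \<open>Strictly between \<open>- pi/2\<close> and \<open>pi/2\<close> the tangent is
  increasing, so bounds on the angle become bounds on the slope. The origin is adjoined because
  wedges require \<open>0 < x\<close>.\<close>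

lemma sector_subset_wedge:
  assumes "- (pi / 2) < a" "b < pi / 2"
  shows "sector a b \<subseteq> insert (0, 0) (squircle_wedge (tan a) (tan b))"
proof
  fix p
  assume p: "p \<in> sector a b"
  then obtain \<phi> u where u: "p = u *\<^sub>R squircle_point \<phi>" "0 \<le> u" "u \<le> 1" "a \<le> \<phi>" "\<phi> \<le> b"
    by (auto simp: mem_sector_iff)
  define q where "q = u / root 4 (cos \<phi> ^ 4 + sin \<phi> ^ 4)"
  have p_eq: "p = (q * cos \<phi>, q * sin \<phi>)"
    by (simp add: u q_def squircle_point_def Let_def)
  show "p \<in> insert (0, 0) (squircle_wedge (tan a) (tan b))"
  proof (cases "u = 0")
    case True
    then show ?thesis
      by (simp add: p_eq q_def)
  next
    case False
    have cos: "cos \<phi> > 0"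
      using u assms by (intro cos_gt_zero_pi) auto
    have q: "q > 0"
      using False u cos4_sin4_pos[of \<phi>] by (simp add: q_def)
    have "tan a \<le> tan \<phi>" "tan \<phi> \<le> tan b"
      using u assms by (auto intro!: tan_mono_le)
    moreover have "q * sin \<phi> = tan \<phi> * (q * cos \<phi>)"
      using cos by (simp add: tan_def)
    ultimately have "tan a * (q * cos \<phi>) \<le> q * sin \<phi>" "q * sin \<phi> \<le> tan b * (q * cos \<phi>)"
      using cos q by simp_all
    moreover have "(q * cos \<phi>) ^ 4 + (q * sin \<phi>) ^ 4 \<le> 1"
      using sector_subset_disc p by (auto simp: p_eq squircle_disc_def)
    ultimately show ?thesis
      using cos q by (simp add: p_eq squircle_wedge_def)
  qed
qed

lemma sector_measure_le_right:
  assumes "- (pi / 2) < a" "a \<le> b" "b < pi / 2"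
  shows "emeasure lborel (sector a b) \<le> ennreal (sector_area b - sector_area a)"
proof -
  have "emeasure lborel (sector a b) \<le> emeasure lborel (insert (0, 0) (squircle_wedge (tan a) (tan b)))"
    using assms by (intro emeasure_mono sector_subset_wedge) auto
  also have "\<dots> = ennreal (sector_area (arctan (tan b)) - sector_area (arctan (tan a)))"
    using assms by (simp add: emeasure_lborel_insert emeasure_squircle_wedge tan_mono_le)
  finally show ?thesis
    using assms by (simp add: arctan_tan)
qed

text \<open>A quarter turn preserves the measure on the left and adds the same constant to both
  values of \<open>sector_area\<close> on the right, so the bound is carried out of the right
  half-plane.\<close>

lemma sector_measure_le_turned:
  assumes "- (pi / 2) < a" "a \<le> b" "b < pi / 2"
  shows "emeasure lborel (sector (a + of_nat n * (pi / 2)) (b + of_nat n * (pi / 2))) \<le>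
      ennreal (sector_area (b + of_nat n * (pi / 2)) - sector_area (a + of_nat n * (pi / 2)))"
proof (induction n)
  case 0
  then show ?case
    using sector_measure_le_right[OF assms] by simp
next
  case (Suc n)
  have shift: "x + of_nat (Suc n) * (pi / 2) = x + of_nat n * (pi / 2) + pi / 2" for x :: real
    by (simp add: field_simps)
  show ?case
    unfolding shift sector_add_half_pi emeasure_quarter_turn[OF sector_borel] sector_area_add_half_pi
    using Suc by (simp only: add_diff_cancel_right)
qed

lemma sector_split:
  assumes "a \<le> b" "b \<le> c"
  shows "sector a c = sector a b \<union> sector b c"
  unfolding sector_def UN_Un[symmetric] ivl_disj_un_two_touch(4)[OF assms] ..

text \<open>Subadditivity suffices for an upper bound, so the common ray of the two sectors need not
  be shown to be null.\<close>

lemma sector_measure_le_split: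
  assumes "a \<le> b" "b \<le> c"
    and "emeasure lborel (sector a b) \<le> ennreal (sector_area b - sector_area a)"
    and "emeasure lborel (sector b c) \<le> ennreal (sector_area c - sector_area b)"
  shows "emeasure lborel (sector a c) \<le> ennreal (sector_area c - sector_area a)"
proof -
  have mono: "sector_area a \<le> sector_area b" "sector_area b \<le> sector_area c"
    using assms strict_mono_less_eq[OF sector_area_strict_mono] by auto
  have "emeasure lborel (sector a c) = emeasure lborel (sector a b \<union> sector b c)"
    using assms by (simp add: sector_split[of a b c])
  also have "\<dots> \<le> emeasure lborel (sector a b) + emeasure lborel (sector b c)"
    by (intro emeasure_subadditive) (auto simp: sector_borel)
  also have "\<dots> \<le> ennreal (sector_area b - sector_area a) + ennreal (sector_area c - sector_area b)"
    using assms by (intro add_mono)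
  also have "\<dots> = ennreal (sector_area c - sector_area a)"
    using mono by (simp add: ennreal_plus[symmetric] del: ennreal_plus)
  finally show ?thesis .
qed

text \<open>An octant, unlike some quadrants placed at arbitrary angles, can always be brought into
  the open right half-plane by quarter turns, away from the vertical axis where slopes fail.\<close>

lemma sector_measure_le_octant:
  assumes "of_nat n * (pi / 4) \<le> a" "a \<le> b" "b \<le> of_nat (Suc n) * (pi / 4)"
  shows "emeasure lborel (sector a b) \<le> ennreal (sector_area b - sector_area a)"
proof -
  \<comment> \<open>The octant starts or ends at \<open>k * (pi/2)\<close>; turning back by this
    angle puts it inside \<open>[- pi/4, pi/4]\<close>.\<close>
  define k where "k = (n + 1) div 2"
  have "n = 2 * k \<or> Suc n = 2 * k"
    unfolding k_def by presburger
  then have n: "real n = 2 * real k \<or> real n = 2 * real k - 1"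
    by auto
  then have "real n * (pi / 4) = real k * (pi / 2) \<or> real n * (pi / 4) = real k * (pi / 2) - pi / 4"
    by (elim disjE) (simp_all only: left_diff_distrib, simp_all)
  moreover have "real (Suc n) * (pi / 4) = real n * (pi / 4) + pi / 4"
    by (simp add: algebra_simps)
  ultimately have "- (pi / 2) < a - of_nat k * (pi / 2)" "b - of_nat k * (pi / 2) < pi / 2"
    using assms pi_gt_zero by linarith+
  then show ?thesis
    using sector_measure_le_turned[of "a - of_nat k * (pi / 2)" "b - of_nat k * (pi / 2)" k] assms by simp
qed

text \<open>Induction on the number of octants needed to reach \<open>b\<close>: a sector that
  crosses the last multiple of \<open>pi/4\<close> is cut there.\<close>

lemma sector_measure_le:
  assumes "0 \<le> a" "a \<le> b"
  shows "emeasure lborel (sector a b) \<le> ennreal (sector_area b - sector_area a)"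
proof -
  have "emeasure lborel (sector a b) \<le> ennreal (sector_area b - sector_area a)"
    if "a \<le> b" "b \<le> of_nat n * (pi / 4)" for n b
    using that
  proof (induction n arbitrary: b)
    case 0
    then have "a = 0" "b = 0"
      using assms by auto
    then show ?case
      using sector_measure_le_right[of 0 0] by simp
  next
    case (Suc n)
    let ?m = "of_nat n * (pi / 4)"
    consider "b \<le> ?m" | "?m \<le> a" | "a \<le> ?m" "?m \<le> b"
      by linarith
    then show ?case
    proof cases
      case 1
      then show ?thesis
        using Suc by blast
    next
      case 2
      then show ?thesis
        using Suc.prems by (intro sector_measure_le_octant)
    next
      case 3
      show ?thesis
      proof (rule sector_measure_le_split[OF 3])
        show "emeasure lborel (sector a ?m) \<le> ennreal (sector_area ?m - sector_area a)"
          using Suc.IH 3 by blast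
        show "emeasure lborel (sector ?m b) \<le> ennreal (sector_area b - sector_area ?m)"
          using 3 Suc.prems by (intro sector_measure_le_octant) auto
      qed
    qed
  qed
  moreover obtain n where "b \<le> of_nat n * (pi / 4)"
    using reals_Archimedean3[of "pi / 4"] pi_gt_zero by (meson divide_pos_pos less_imp_le zero_less_numeral)
  ultimately show ?thesis
    using assms by blast
qed

section \<open>Lower bound for the whole squircle and exact sector areas\<close>

text \<open>The wedge of slopes between \<open>- m\<close> and \<open>m\<close> and its image under
  a half turn are disjoint parts of the disc. As \<open>m\<close> grows, their total area tends to
  the left-hand side.\<close>

lemma sector_area_le_squircle_area: "sector_area (2 * pi) \<le> squircle_area"
proof -
  have fin: "emeasure lborel squircle_disc \<noteq> \<infinity>"
    unfolding sector_full[symmetric] using emeasure_compact_finite[OF compact_sector] by (simp add: less_top)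
  have "2 * (sector_area (arctan m) - sector_area (arctan (- m))) \<le> squircle_area" if "m \<ge> 0" for m
  proof -
    let ?W = "squircle_wedge (- m) m"
    let ?W' = "quarter_turn ` quarter_turn ` ?W"
    let ?A = "sector_area (arctan m) - sector_area (arctan (- m))"
    have A: "?A \<ge> 0"
      using that strict_mono_less_eq[OF sector_area_strict_mono] by (simp add: arctan_minus)
    have "ennreal (2 * ?A) = ennreal ?A + ennreal ?A"
      using A by (simp add: ennreal_plus[symmetric] del: ennreal_plus)
    also have "\<dots> = emeasure lborel ?W + emeasure lborel ?W'"
      using that by (simp add: emeasure_quarter_turn quarter_turn_image_borel emeasure_squircle_wedge)
    also have "\<dots> = emeasure lborel (?W \<union> ?W')"
      \<comment> \<open>Two quarter turns negate both coordinates, so the sign of the first one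
        separates the wedges.\<close>
      by (intro plus_emeasure)
        (auto simp: quarter_turn_image_borel, auto simp: quarter_turn_def squircle_wedge_def)
    also have "\<dots> \<le> emeasure lborel squircle_disc"
      by (intro emeasure_mono) (use closed_squircle_disc in
        \<open>auto simp: quarter_turn_def squircle_wedge_def squircle_disc_def\<close>)
    also have "\<dots> = ennreal squircle_area"
      using fin by (simp add: squircle_area_def squircle_disc_def emeasure_eq_ennreal_measure)
    finally show ?thesis
      by (simp add: squircle_area_def)
  qed
  then have "\<forall>\<^sub>F m in at_top. 2 * (sector_area (arctan m) - sector_area (arctan (- m))) \<le> squircle_area"
    by (rule eventually_mono[OF eventually_ge_at_top[of 0]])
  moreover have "((\<lambda>m. 2 * (sector_area (arctan m) - sector_area (arctan (- m)))) \<longlongrightarrow>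
      2 * (sector_area (pi / 2) - sector_area (- (pi / 2)))) at_top"
    unfolding arctan_minus
    by (intro tendsto_intros isCont_tendsto_compose[OF DERIV_isCont[OF DERIV_sector_area]] tendsto_arctan_at_top)
  ultimately have "2 * (sector_area (pi / 2) - sector_area (- (pi / 2))) \<le> squircle_area"
    by (intro tendsto_upperbound) auto
  moreover have "2 * (sector_area (pi / 2) - sector_area (- (pi / 2))) = sector_area (2 * pi)"
    using cos_arc_add_nat_pi[of 0 4] by (simp add: sector_area_def cos_arc_minus field_simps)
  ultimately show ?thesis
    by simp
qed

text \<open>The sectors from 0 to \<open>\<theta>\<close> and from \<open>\<theta>\<close> to
  \<open>2 * pi\<close> cover the squircle. Their upper bounds add up to
  \<open>sector_area (2 * pi)\<close>, which is at most the total area, so both bounds are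
  attained.\<close>

lemma measure_swept_region:
  assumes "0 \<le> \<theta>" "\<theta> \<le> 2 * pi"
  shows "measure lborel (swept_region \<theta>) = sector_area \<theta>"
proof -
  have le: "measure lborel (sector a b) \<le> sector_area b - sector_area a" if "0 \<le> a" "a \<le> b" for a b
    using sector_measure_le[OF that] strict_mono_less_eq[OF sector_area_strict_mono] that
    by (simp add: measure_def enn2real_leI)
  have "squircle_area = measure lborel (sector 0 (2 * pi))"
    by (simp add: sector_full squircle_area_def squircle_disc_def)
  also have "sector 0 (2 * pi) = sector 0 \<theta> \<union> sector \<theta> (2 * pi)"
    using assms by (rule sector_split)
  also have "measure lborel \<dots> \<le> measure lborel (sector 0 \<theta>) + measure lborel (sector \<theta> (2 * pi))"
    by (intro measure_Un_le) (auto simp: sector_borel)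
  finally have "squircle_area \<le> measure lborel (sector 0 \<theta>) + measure lborel (sector \<theta> (2 * pi))" .
  then show ?thesis
    using le[of 0 \<theta>] le[of \<theta> "2 * pi"] assms sector_area_le_squircle_area
    by (simp add: swept_region_eq_sector)
qed

lemma squircle_area_eq: "squircle_area = sector_area (2 * pi)"
  using measure_swept_region[of "2 * pi"]
  by (simp add: swept_region_eq_sector sector_full squircle_area_def squircle_disc_def)

section \<open>The angle of the particle\<close>

text \<open>One revolution takes time \<open>T\<close> with
  \<open>sqrt 2 * T = 4 * cos_arc pi\<close>, so restoring the \<open>k\<close> revolutions removed
  from \<open>t\<close> adds \<open>4 * k * pi\<close> to the doubled angle.\<close>

lemma sqrt2_mult_eq_cos_arc:
  obtains k :: int where "sqrt 2 * t = cos_arc (2 * squircular_angle t + of_int (4 * k) * pi)"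
proof -
  define T where "T = 2 * squircle_area"
  define k where "k = \<lfloor>t / T\<rfloor>"
  define s where "s = t - T * of_int k"
  have "sector_area 0 < sector_area (2 * pi)"
    using strict_mono_less[OF sector_area_strict_mono, of 0 "2 * pi"] pi_gt_zero by linarith
  then have T: "T > 0"
    by (simp add: T_def squircle_area_eq)
  have s: "0 \<le> s" "s < T"
    using T floor_divide_lower[OF T, of t] floor_divide_upper[OF T, of t]
    by (simp_all add: s_def k_def algebra_simps)
  have "\<exists>\<theta>\<ge>0. \<theta> \<le> 2 * pi \<and> sector_area \<theta> = s / 2"
    using s by (intro IVT) (auto simp: T_def squircle_area_eq intro: DERIV_isCont[OF DERIV_sector_area])
  then obtain \<theta> where \<theta>: "0 \<le> \<theta>" "\<theta> \<le> 2 * pi" "sector_area \<theta> = s / 2"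
    by blast
  \<comment> \<open>The intermediate value theorem yields a closed interval, while the description
    of the angle requires \<open>\<theta> < 2 * pi\<close>; the strict bound \<open>s < T\<close>
    closes this gap.\<close>
  have "\<theta> \<noteq> 2 * pi"
    using \<theta>(3) s by (auto simp: T_def squircle_area_eq)
  have "squircular_angle t = (THE \<theta>. 0 \<le> \<theta> \<and> \<theta> < 2 * pi \<and> measure lborel (swept_region \<theta>) = s / 2)"
    by (simp add: squircular_angle_def Let_def T_def s_def k_def)
  also have "\<dots> = \<theta>"
  proof (rule the_equality)
    show "0 \<le> \<theta> \<and> \<theta> < 2 * pi \<and> measure lborel (swept_region \<theta>) = s / 2"
      using \<theta> \<open>\<theta> \<noteq> 2 * pi\<close> by (simp add: measure_swept_region)
    fix \<eta>
    assume "0 \<le> \<eta> \<and> \<eta> < 2 * pi \<and> measure lborel (swept_region \<eta>) = s / 2"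
    then have "sector_area \<eta> = sector_area \<theta>"
      using \<theta> measure_swept_region[of \<eta>] by simp
    then show "\<eta> = \<theta>"
      by (simp add: strict_mono_eq[OF sector_area_strict_mono])
  qed
  finally have angle: "squircular_angle t = \<theta>" .
  have "cos_arc (2 * \<theta>) = sqrt 2 * s"
    using \<theta>(3) by (simp add: sector_area_def field_simps)
  moreover have "sqrt 2 * T = 4 * cos_arc pi"
    using cos_arc_add_nat_pi[of 0 4] by (simp add: T_def squircle_area_eq sector_area_def)
  ultimately have "sqrt 2 * t = cos_arc (2 * \<theta> + of_int (4 * k) * pi)"
    unfolding cos_arc_add_int_pi s_def by simp algebra
  then show thesis
    using that angle by blast
qed

text \<open>The quotient is homogeneous of degree 0, so the polar radius cancels and the
  double-angle formula remains.\<close>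

lemma squircle_point_ratio:
  fixes \<phi> :: real
  defines "x \<equiv> fst (squircle_point \<phi>)" and "y \<equiv> snd (squircle_point \<phi>)"
  shows "(x\<^sup>2 - y\<^sup>2) / (x\<^sup>2 + y\<^sup>2) = cos (2 * \<phi>)"
proof -
  define \<rho> where "\<rho> = 1 / root 4 (cos \<phi> ^ 4 + sin \<phi> ^ 4)"
  have "\<rho> \<noteq> 0"
    using cos4_sin4_pos[of \<phi>] by (simp add: \<rho>_def)
  have xy: "x = \<rho> * cos \<phi>" "y = \<rho> * sin \<phi>"
    by (simp_all add: x_def y_def squircle_point_def Let_def \<rho>_def)
  have "x\<^sup>2 - y\<^sup>2 = \<rho>\<^sup>2 * cos (2 * \<phi>)" "x\<^sup>2 + y\<^sup>2 = \<rho>\<^sup>2 * ((sin \<phi>)\<^sup>2 + (cos \<phi>)\<^sup>2)"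
    unfolding xy cos_double by algebra+
  then show ?thesis
    using \<open>\<rho> \<noteq> 0\<close> by simp
qed

theorem theorem9:
  fixes t :: real
  shows "cl (sqrt 2 * t) = ((cos4 t)\<^sup>2 - (sin4 t)\<^sup>2) / ((cos4 t)\<^sup>2 + (sin4 t)\<^sup>2)"
proof -
  obtain k :: int where k: "sqrt 2 * t = cos_arc (2 * squircular_angle t + of_int (4 * k) * pi)"
    by (rule sqrt2_mult_eq_cos_arc)
  have "cl (sqrt 2 * t) = cos (2 * squircular_angle t + 2 * pi * of_int (2 * k))"
    unfolding k cl_cos_arc by (simp add: algebra_simps)
  also have "\<dots> = cos (2 * squircular_angle t)"
    by (simp add: cos_add cos_int_2pin sin_int_2pin del: of_int_mult)
  finally show ?thesis
    by (simp add: cos4_def sin4_def squircle_point_ratio)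
qed

end
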